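(* Let $R$ be a (not necessarily commutative) domain having invariant basis number, $\sigma\in\mathrm{Aut}(R)$, $0\neq a\in Z(R)$, and let $A=R(\sigma,a)$ be the corresponding generalized Weyl algebra. Then any $A$-module whose restriction to $R$ is isomorphic, as a left $R$-module, to the left regular module ${}_RR$ is isomorphic as an $A$-module to $V_{\mathsf p}$ for some $\mathsf p\in R$ that divides $a$.
   Context: Rings and (left) modules are unital. $Z(R)$ is the center of $R$. For a ring $R$, an automorphism $\sigma\in\mathrm{Aut}(R)$ and $a\in Z(R)$, the generalized Weyl algebra $R(\sigma,a)$ is the ring generated by $R$, $x$, $y$ subject to the relations $x\sigma(r)=rx$, $yr=\sigma(r)y$ for all $r\in R$, $xy=a$, $yx=\sigma(a)$. Since $R$ is a domain and $a\ne 0$ is central, if $a=v\mathsf p$ with $v,\mathsf p\in R$ then also $a=\mathsf p v$, and $v$ is uniquely determined by $\mathsf p$; so one says unambiguously that $\mathsf p$ divides $a$ and writes $v=\frac{a}{\mathsf p}$. For a divisor $\mathsf p$ of $a$ put $\mathsf q=\sigma\left(\frac{a}{\mathsf p}\right)$, so $a=\sigma^{-1}(\mathsf q)\mathsf p$. The $A$-module $V_{\mathsf p}$ is $R$ as an abelian group, with action $r'\cdot r=r'r$, $x\cdot r=\sigma^{-1}(r)\mathsf p$, $y\cdot r=\sigma(r)\mathsf q$ for $r,r'\in R$. *)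

theory Defs
  imports "HOL-Algebra.QuotRing" "HOL-Algebra.Module" "HOL-Library.Poly_Mapping"
begin

section \<open>Noncommutative domains, left modules, invariant basis number\<close>

text \<open>
  The locales \<^locale>\<open>domain\<close> and \<^locale>\<open>module\<close> of HOL-Algebra presuppose a commutative ring,
  hence the noncommutative versions below.
\<close>

locale noncomm_domain = ring R for R (structure) +
  assumes one_not_zero: "\<one> \<noteq> \<zero>"
    and integral: "\<lbrakk>r \<in> carrier R; s \<in> carrier R; r \<otimes> s = \<zero>\<rbrakk> \<Longrightarrow> r = \<zero> \<or> s = \<zero>"

definition ring_center :: "('r, 'b) ring_scheme \<Rightarrow> 'r set" where
  "ring_center R = {z \<in> carrier R. \<forall>r\<in>carrier R. z \<otimes>\<^bsub>R\<^esub> r = r \<otimes>\<^bsub>R\<^esub> z}"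

locale left_module = R?: ring R + M?: abelian_group M for R (structure) and M (structure) +
  assumes smult_closed:
      "\<lbrakk>r \<in> carrier R; m \<in> carrier M\<rbrakk> \<Longrightarrow> r \<odot>\<^bsub>M\<^esub> m \<in> carrier M"
    and smult_l_distr:
      "\<lbrakk>r \<in> carrier R; s \<in> carrier R; m \<in> carrier M\<rbrakk> \<Longrightarrow>
        (r \<oplus> s) \<odot>\<^bsub>M\<^esub> m = r \<odot>\<^bsub>M\<^esub> m \<oplus>\<^bsub>M\<^esub> s \<odot>\<^bsub>M\<^esub> m"
    and smult_r_distr:
      "\<lbrakk>r \<in> carrier R; m \<in> carrier M; n \<in> carrier M\<rbrakk> \<Longrightarrow>
        r \<odot>\<^bsub>M\<^esub> (m \<oplus>\<^bsub>M\<^esub> n) = r \<odot>\<^bsub>M\<^esub> m \<oplus>\<^bsub>M\<^esub> r \<odot>\<^bsub>M\<^esub> n"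
    and smult_assoc:
      "\<lbrakk>r \<in> carrier R; s \<in> carrier R; m \<in> carrier M\<rbrakk> \<Longrightarrow>
        (r \<otimes> s) \<odot>\<^bsub>M\<^esub> m = r \<odot>\<^bsub>M\<^esub> (s \<odot>\<^bsub>M\<^esub> m)"
    and smult_one: "m \<in> carrier M \<Longrightarrow> \<one> \<odot>\<^bsub>M\<^esub> m = m"

text \<open>
  The record type of modules extends that of rings; its fields \<^const>\<open>mult\<close> and \<^const>\<open>one\<close>
  play no role for modules.
\<close>

definition left_module_iso ::
    "('r, 'b) ring_scheme \<Rightarrow> ('r, 'm, 'c) module_scheme \<Rightarrow> ('r, 'n, 'd) module_scheme \<Rightarrow> ('m \<Rightarrow> 'n) set"
  where
  "left_module_iso R M N =
    {h. bij_betw h (carrier M) (carrier N) \<and>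
        (\<forall>m\<in>carrier M. \<forall>m'\<in>carrier M. h (m \<oplus>\<^bsub>M\<^esub> m') = h m \<oplus>\<^bsub>N\<^esub> h m') \<and>
        (\<forall>r\<in>carrier R. \<forall>m\<in>carrier M. h (r \<odot>\<^bsub>M\<^esub> m) = r \<odot>\<^bsub>N\<^esub> h m)}"

definition left_module_isomorphic ::
    "('r, 'b) ring_scheme \<Rightarrow> ('r, 'm, 'c) module_scheme \<Rightarrow> ('r, 'n, 'd) module_scheme \<Rightarrow> bool"
  where "left_module_isomorphic R M N \<longleftrightarrow> left_module_iso R M N \<noteq> {}"

definition regular_module :: "('r, 'b) ring_scheme \<Rightarrow> ('r, 'r) module" where
  "regular_module R =
    \<lparr>carrier = carrier R, mult = mult R, one = one R, zero = zero R, add = add R, smult = mult R\<rparr>"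

definition restrict_scalars ::
    "('r \<Rightarrow> 's) \<Rightarrow> ('s, 'm, 'c) module_scheme \<Rightarrow> ('r, 'm) module" where
  "restrict_scalars \<iota> M =
    \<lparr>carrier = carrier M, mult = mult M, one = one M, zero = zero M, add = add M,
     smult = (\<lambda>r m. \<iota> r \<odot>\<^bsub>M\<^esub> m)\<rparr>"

definition free_left_module :: "('r, 'b) ring_scheme \<Rightarrow> nat \<Rightarrow> ('r, nat \<Rightarrow> 'r) module" where
  "free_left_module R n =
    \<lparr>carrier = {..<n} \<rightarrow>\<^sub>E carrier R, mult = undefined, one = undefined,
     zero = (\<lambda>i\<in>{..<n}. \<zero>\<^bsub>R\<^esub>), add = (\<lambda>u v. \<lambda>i\<in>{..<n}. u i \<oplus>\<^bsub>R\<^esub> v i),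
     smult = (\<lambda>r v. \<lambda>i\<in>{..<n}. r \<otimes>\<^bsub>R\<^esub> v i)\<rparr>"

definition invariant_basis_number :: "('r, 'b) ring_scheme \<Rightarrow> bool" where
  "invariant_basis_number R \<longleftrightarrow>
    (\<forall>m n. left_module_isomorphic R (free_left_module R m) (free_left_module R n) \<longrightarrow> m = n)"


section \<open>Generalized Weyl algebras by generators and relations\<close>

text \<open>
  Lists form the free monoid, so that \<open>'g list \<Rightarrow>\<^sub>0 int\<close> with the convolution product of
  \<^theory>\<open>HOL-Library.Poly_Mapping\<close> is the free (associative, unital) ring on \<open>'g\<close>.
\<close>

instantiation list :: (type) monoid_add
begin

definition zero_list :: "'a list" where "zero_list = []"

definition plus_list :: "'a list \<Rightarrow> 'a list \<Rightarrow> 'a list" where "plus_list = (@)"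

instance by standard (simp_all add: zero_list_def plus_list_def)

end

definition free_ring :: "'g set \<Rightarrow> ('g list \<Rightarrow>\<^sub>0 int) ring" where
  "free_ring G =
    \<lparr>carrier = {f. Poly_Mapping.keys f \<subseteq> lists G}, mult = (*), one = 1, zero = 0, add = (+)\<rparr>"

datatype 'r gwa_gen = Coeff 'r | GenX | GenY

definition gwa_gens :: "('r, 'b) ring_scheme \<Rightarrow> 'r gwa_gen set" where
  "gwa_gens R = Coeff ` carrier R \<union> {GenX, GenY}"

definition gen :: "'g \<Rightarrow> 'g list \<Rightarrow>\<^sub>0 int" where
  "gen g = Poly_Mapping.single [g] 1"

text \<open>
  ``Generated by \<open>R\<close>, \<open>x\<close>, \<open>y\<close>'' means that the ring operations of \<open>R\<close> are to be respected, which is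
  expressed by the first three families of relations. A relation \<open>u = v\<close> is listed as \<open>u - v\<close>.
\<close>

definition gwa_relations ::
    "('r, 'b) ring_scheme \<Rightarrow> ('r \<Rightarrow> 'r) \<Rightarrow> 'r \<Rightarrow> ('r gwa_gen list \<Rightarrow>\<^sub>0 int) set" where
  "gwa_relations R \<sigma> a =
     {gen (Coeff (r \<oplus>\<^bsub>R\<^esub> s)) - (gen (Coeff r) + gen (Coeff s)) | r s. r \<in> carrier R \<and> s \<in> carrier R}
   \<union> {gen (Coeff (r \<otimes>\<^bsub>R\<^esub> s)) - gen (Coeff r) * gen (Coeff s) | r s. r \<in> carrier R \<and> s \<in> carrier R}
   \<union> {gen (Coeff \<one>\<^bsub>R\<^esub>) - 1}
   \<union> {gen GenX * gen (Coeff (\<sigma> r)) - gen (Coeff r) * gen GenX | r. r \<in> carrier R}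
   \<union> {gen GenY * gen (Coeff r) - gen (Coeff (\<sigma> r)) * gen GenY | r. r \<in> carrier R}
   \<union> {gen GenX * gen GenY - gen (Coeff a), gen GenY * gen GenX - gen (Coeff (\<sigma> a))}"

definition gwa_ideal ::
    "('r, 'b) ring_scheme \<Rightarrow> ('r \<Rightarrow> 'r) \<Rightarrow> 'r \<Rightarrow> ('r gwa_gen list \<Rightarrow>\<^sub>0 int) set" where
  "gwa_ideal R \<sigma> a = Idl\<^bsub>free_ring (gwa_gens R)\<^esub> (gwa_relations R \<sigma> a)"

definition GWA ::
    "('r, 'b) ring_scheme \<Rightarrow> ('r \<Rightarrow> 'r) \<Rightarrow> 'r \<Rightarrow> ('r gwa_gen list \<Rightarrow>\<^sub>0 int) set ring" where
  "GWA R \<sigma> a = free_ring (gwa_gens R) Quot gwa_ideal R \<sigma> a"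

definition gwa_gen_class ::
    "('r, 'b) ring_scheme \<Rightarrow> ('r \<Rightarrow> 'r) \<Rightarrow> 'r \<Rightarrow> 'r gwa_gen \<Rightarrow> ('r gwa_gen list \<Rightarrow>\<^sub>0 int) set" where
  "gwa_gen_class R \<sigma> a g = gwa_ideal R \<sigma> a +>\<^bsub>free_ring (gwa_gens R)\<^esub> gen g"

definition gwa_coeff ::
    "('r, 'b) ring_scheme \<Rightarrow> ('r \<Rightarrow> 'r) \<Rightarrow> 'r \<Rightarrow> 'r \<Rightarrow> ('r gwa_gen list \<Rightarrow>\<^sub>0 int) set" where
  "gwa_coeff R \<sigma> a r = gwa_gen_class R \<sigma> a (Coeff r)"


section \<open>The modules \<open>V\<^sub>p\<close>\<close>

text \<open>
  Over a domain \<open>R\<close> and for central \<open>a \<noteq> 0\<close>, cofactors commute with divisors and are unique; see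
  \<open>central_cofactor_commutes\<close> and \<open>cofactor_eq\<close> below.
\<close>

definition central_divides :: "('r, 'b) ring_scheme \<Rightarrow> 'r \<Rightarrow> 'r \<Rightarrow> bool" where
  "central_divides R p a \<longleftrightarrow> p \<in> carrier R \<and> (\<exists>v\<in>carrier R. a = v \<otimes>\<^bsub>R\<^esub> p)"

definition cofactor :: "('r, 'b) ring_scheme \<Rightarrow> 'r \<Rightarrow> 'r \<Rightarrow> 'r" where
  "cofactor R a p = (THE v. v \<in> carrier R \<and> a = v \<otimes>\<^bsub>R\<^esub> p)"

fun V_gen_act ::
    "('r, 'b) ring_scheme \<Rightarrow> ('r \<Rightarrow> 'r) \<Rightarrow> 'r \<Rightarrow> 'r \<Rightarrow> 'r gwa_gen \<Rightarrow> 'r \<Rightarrow> 'r" where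
  "V_gen_act R \<sigma> a p (Coeff r') r = r' \<otimes>\<^bsub>R\<^esub> r"
| "V_gen_act R \<sigma> a p GenX r = inv_into (carrier R) \<sigma> r \<otimes>\<^bsub>R\<^esub> p"
| "V_gen_act R \<sigma> a p GenY r = \<sigma> r \<otimes>\<^bsub>R\<^esub> \<sigma> (cofactor R a p)"

definition V_free_act ::
    "('r, 'b) ring_scheme \<Rightarrow> ('r \<Rightarrow> 'r) \<Rightarrow> 'r \<Rightarrow> 'r \<Rightarrow> ('r gwa_gen list \<Rightarrow>\<^sub>0 int) \<Rightarrow> 'r \<Rightarrow> 'r" where
  "V_free_act R \<sigma> a p f r =
    (\<Oplus>\<^bsub>R\<^esub>w\<in>Poly_Mapping.keys f. [Poly_Mapping.lookup f w] \<cdot>\<^bsub>R\<^esub> foldr (V_gen_act R \<sigma> a p) w r)"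

text \<open>
  An element \<open>\<alpha>\<close> of the algebra is a coset of elements of the free ring, all of which act in the same
  way when \<open>p\<close> divides \<open>a\<close>; see \<open>left_module_V\<close> below.
\<close>

definition V_module ::
    "('r, 'b) ring_scheme \<Rightarrow> ('r \<Rightarrow> 'r) \<Rightarrow> 'r \<Rightarrow> 'r \<Rightarrow> (('r gwa_gen list \<Rightarrow>\<^sub>0 int) set, 'r) module" where
  "V_module R \<sigma> a p =
    \<lparr>carrier = carrier R, mult = mult R, one = one R, zero = zero R, add = add R,
     smult = (\<lambda>\<alpha> r. the_elem ((\<lambda>f. V_free_act R \<sigma> a p f r) ` \<alpha>))\<rparr>"


section \<open>Well-definedness\<close>

lemma free_ring_simps:
  "carrier (free_ring G) = {f. Poly_Mapping.keys f \<subseteq> lists G}"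
  "f \<oplus>\<^bsub>free_ring G\<^esub> g = f + g" "f \<otimes>\<^bsub>free_ring G\<^esub> g = f * g"
  "\<zero>\<^bsub>free_ring G\<^esub> = 0" "\<one>\<^bsub>free_ring G\<^esub> = 1"
  by (simp_all add: free_ring_def)

lemma free_ring_closed:
  assumes "f \<in> carrier (free_ring G)" "g \<in> carrier (free_ring G)"
  shows "f + g \<in> carrier (free_ring G)" "f - g \<in> carrier (free_ring G)"
    "f * g \<in> carrier (free_ring G)"
proof -
  show "f + g \<in> carrier (free_ring G)"
    using assms Poly_Mapping.keys_add[of f g] by (auto simp: free_ring_simps)
  show "f - g \<in> carrier (free_ring G)"
    using assms keys_diff[of f g] by (auto simp: free_ring_simps)
  show "f * g \<in> carrier (free_ring G)"
    using assms keys_mult[of f g] by (fastforce simp: free_ring_simps plus_list_def)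
qed

lemma free_ring_uminus: "f \<in> carrier (free_ring G) \<Longrightarrow> - f \<in> carrier (free_ring G)"
  by (simp add: free_ring_simps)

lemma one_list_single: "(1 :: 'g list \<Rightarrow>\<^sub>0 int) = Poly_Mapping.single [] 1"
  by (metis single_one zero_list_def)

lemma zero_one_in_free_ring: "0 \<in> carrier (free_ring G)" "1 \<in> carrier (free_ring G)"
  by (auto simp: free_ring_simps one_list_single)

lemma ring_free_ring: "ring (free_ring G)"
proof (rule ringI)
  show "abelian_group (free_ring G)"
  proof (rule abelian_groupI)
    fix x assume x: "x \<in> carrier (free_ring G)"
    show "\<exists>y\<in>carrier (free_ring G). y \<oplus>\<^bsub>free_ring G\<^esub> x = \<zero>\<^bsub>free_ring G\<^esub>"
      by (rule bexI[of _ "- x"]) (use x in \<open>auto simp: free_ring_simps(2-) free_ring_uminus\<close>)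
  qed (auto simp: free_ring_simps(2-) free_ring_closed zero_one_in_free_ring algebra_simps)
  show "monoid (free_ring G)"
    by (rule monoidI)
      (auto simp: free_ring_simps(2-) free_ring_closed zero_one_in_free_ring algebra_simps)
qed (auto simp: free_ring_simps(2-) algebra_simps)

lemma gen_in_free_ring: "g \<in> G \<Longrightarrow> gen g \<in> carrier (free_ring G)"
  by (auto simp: free_ring_simps gen_def)

lemma sum_monomials:
  "(\<Sum>w\<in>Poly_Mapping.keys f. Poly_Mapping.single w (Poly_Mapping.lookup f w)) = f"
  by (rule poly_mapping_eqI)
    (auto simp: lookup_sum lookup_single when_def sum.delta in_keys_iff)

lemma free_ring_induct [consumes 1, case_names zero add]:
  assumes "f \<in> carrier (free_ring G)" "P 0"
    and "\<And>w k g. w \<in> lists G \<Longrightarrow> g \<in> carrier (free_ring G) \<Longrightarrow> P g \<Longrightarrow>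
           P (Poly_Mapping.single w k + g)"
  shows "P f"
proof -
  have "finite A \<Longrightarrow> A \<subseteq> lists G \<Longrightarrow> 
      (\<Sum>w\<in>A. Poly_Mapping.single w (c w)) \<in> carrier (free_ring G) \<and>
      P (\<Sum>w\<in>A. Poly_Mapping.single w (c w))" for A and c :: "'a list \<Rightarrow> int"
  proof (induction A rule: finite_induct)
    case empty
    then show ?case using assms(2) zero_one_in_free_ring by auto
  next
    case (insert w A)
    then have "Poly_Mapping.single w (c w) \<in> carrier (free_ring G)"
      by (auto simp: free_ring_simps)
    with insert show ?case
      by (auto intro!: free_ring_closed assms(3))
  qed
  from this[of "Poly_Mapping.keys f" "Poly_Mapping.lookup f"] assms(1)
  show ?thesis by (simp add: free_ring_simps sum_monomials)
qed

locale gwa_data = noncomm_domain R for R (structure) +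
  fixes \<sigma> :: "'a \<Rightarrow> 'a" and a :: 'a
  assumes \<sigma>_iso: "\<sigma> \<in> ring_iso R R"
    and a_center: "a \<in> ring_center R"
    and a_nonzero: "a \<noteq> \<zero>"
begin

abbreviation "F \<equiv> free_ring (gwa_gens R)"
abbreviation "I \<equiv> gwa_ideal R \<sigma> a"
abbreviation "\<tau> \<equiv> inv_into (carrier R) \<sigma>"

lemma \<sigma>_bij: "bij_betw \<sigma> (carrier R) (carrier R)"
  and \<sigma>_closed [simp]: "r \<in> carrier R \<Longrightarrow> \<sigma> r \<in> carrier R"
  and \<sigma>_add: "\<lbrakk>r \<in> carrier R; s \<in> carrier R\<rbrakk> \<Longrightarrow> \<sigma> (r \<oplus> s) = \<sigma> r \<oplus> \<sigma> s"
  and \<sigma>_mult: "\<lbrakk>r \<in> carrier R; s \<in> carrier R\<rbrakk> \<Longrightarrow> \<sigma> (r \<otimes> s) = \<sigma> r \<otimes> \<sigma> s"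
  and \<sigma>_one: "\<sigma> \<one> = \<one>"
  using ring_iso_memE[OF \<sigma>_iso] by auto

lemma \<tau>_\<sigma> [simp]: "r \<in> carrier R \<Longrightarrow> \<tau> (\<sigma> r) = r"
  and \<sigma>_\<tau> [simp]: "r \<in> carrier R \<Longrightarrow> \<sigma> (\<tau> r) = r"
  and \<tau>_closed [simp]: "r \<in> carrier R \<Longrightarrow> \<tau> r \<in> carrier R"
  using \<sigma>_bij bij_betw_inv_into_left bij_betw_inv_into_right bij_betwE[OF bij_betw_inv_into]
  by (metis)+

lemma \<tau>_add: "\<lbrakk>r \<in> carrier R; s \<in> carrier R\<rbrakk> \<Longrightarrow> \<tau> (r \<oplus> s) = \<tau> r \<oplus> \<tau> s"
  using \<sigma>_add[of "\<tau> r" "\<tau> s"] \<tau>_\<sigma>[of "\<tau> r \<oplus> \<tau> s"] by simp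

lemma \<tau>_mult: "\<lbrakk>r \<in> carrier R; s \<in> carrier R\<rbrakk> \<Longrightarrow> \<tau> (r \<otimes> s) = \<tau> r \<otimes> \<tau> s"
  using \<sigma>_mult[of "\<tau> r" "\<tau> s"] \<tau>_\<sigma>[of "\<tau> r \<otimes> \<tau> s"] by simp

lemma a_closed [simp]: "a \<in> carrier R"
  and a_comm: "r \<in> carrier R \<Longrightarrow> a \<otimes> r = r \<otimes> a"
  using a_center by (auto simp: ring_center_def)

lemma \<sigma>a_comm: assumes "r \<in> carrier R" shows "\<sigma> a \<otimes> r = r \<otimes> \<sigma> a"
proof -
  have "\<sigma> a \<otimes> \<sigma> (\<tau> r) = \<sigma> (\<tau> r) \<otimes> \<sigma> a"
    using a_comm[of "\<tau> r"] assms \<sigma>_mult by (metis a_closed \<tau>_closed)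
  with assms show ?thesis by simp
qed

lemma right_cancel:
  assumes "u \<in> carrier R" "v \<in> carrier R" "p \<in> carrier R" "p \<noteq> \<zero>" "u \<otimes> p = v \<otimes> p"
  shows "u = v"
proof -
  have "(u \<ominus> v) \<otimes> p = \<zero>"
    using assms by (simp add: minus_eq l_distr l_minus r_neg)
  with assms have "u \<ominus> v = \<zero>" using integral[of "u \<ominus> v" p] by auto
  with assms have "u = \<ominus> (\<ominus> v)"
    by (intro minus_equality[symmetric]) (auto simp: minus_eq a_comm)
  with assms show ?thesis by simp
qed

lemma central_cofactor_commutes:
  assumes "p \<in> carrier R" "v \<in> carrier R"
  shows "a = v \<otimes> p \<longleftrightarrow> a = p \<otimes> v"
proof -
  have *: "a = q \<otimes> u" if "a = u \<otimes> q" "q \<in> carrier R" "u \<in> carrier R" for u q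
  proof -
    have "u \<noteq> \<zero>" using that a_nonzero by auto
    have "(q \<otimes> u) \<otimes> q = a \<otimes> q"
      using that a_comm[of q] by (simp add: m_assoc)
    moreover have "q \<noteq> \<zero>" using that a_nonzero by auto
    ultimately show ?thesis using right_cancel[of "q \<otimes> u" a q] that by simp
  qed
  show ?thesis using *[of v p] *[of p v] assms by blast
qed

lemma cofactor_eq:
  assumes "p \<in> carrier R" "v \<in> carrier R" "a = v \<otimes> p"
  shows "cofactor R a p = v"
proof -
  have "p \<noteq> \<zero>" using assms a_nonzero by auto
  show ?thesis unfolding cofactor_def
  proof (rule the_equality)
    show "v \<in> carrier R \<and> a = v \<otimes> p" using assms by blast
    fix u assume "u \<in> carrier R \<and> a = u \<otimes> p"
    with assms \<open>p \<noteq> \<zero>\<close> show "u = v" by (intro right_cancel[of u v p]) metis+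
  qed
qed

lemma gens:
  "r \<in> carrier R \<Longrightarrow> Coeff r \<in> gwa_gens R" "GenX \<in> gwa_gens R" "GenY \<in> gwa_gens R"
  by (auto simp: gwa_gens_def)

lemma gens_closed:
  "r \<in> carrier R \<Longrightarrow> gen (Coeff r) \<in> carrier F" "gen GenX \<in> carrier F" "gen GenY \<in> carrier F"
  by (auto intro!: gen_in_free_ring gens)

lemma relations_closed: "gwa_relations R \<sigma> a \<subseteq> carrier F"
  unfolding gwa_relations_def
  by (auto intro!: free_ring_closed gens_closed zero_one_in_free_ring)

lemma ideal_I: "ideal I F"
  unfolding gwa_ideal_def by (rule ring.genideal_ideal[OF ring_free_ring relations_closed])

lemma ring_GWA: "ring (GWA R \<sigma> a)"
  unfolding GWA_def by (rule ideal.quotient_is_ring[OF ideal_I])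

end

locale gwa_divisor = gwa_data +
  fixes p
  assumes divisor: "central_divides R p a"
begin

abbreviation "q \<equiv> \<sigma> (cofactor R a p)"
abbreviation "act \<equiv> V_free_act R \<sigma> a p"
abbreviation "wact w \<equiv> foldr (V_gen_act R \<sigma> a p) w"

lemma p_closed [simp]: "p \<in> carrier R"
  and cofactor_closed [simp]: "cofactor R a p \<in> carrier R"
  and a_eq: "a = cofactor R a p \<otimes> p" "a = p \<otimes> cofactor R a p"
proof -
  obtain v where v: "v \<in> carrier R" "a = v \<otimes> p" and p: "p \<in> carrier R"
    using divisor by (auto simp: central_divides_def)
  then have c: "cofactor R a p = v" by (intro cofactor_eq)
  show "p \<in> carrier R" "cofactor R a p \<in> carrier R" "a = cofactor R a p \<otimes> p"
    using v p c by auto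
  then show "a = p \<otimes> cofactor R a p"
    using central_cofactor_commutes by blast
qed

lemma gen_act_closed:
  "g \<in> gwa_gens R \<Longrightarrow> m \<in> carrier R \<Longrightarrow> V_gen_act R \<sigma> a p g m \<in> carrier R"
  by (auto simp: gwa_gens_def)

lemma gen_act_add:
  "g \<in> gwa_gens R \<Longrightarrow> m \<in> carrier R \<Longrightarrow> n \<in> carrier R \<Longrightarrow>
    V_gen_act R \<sigma> a p g (m \<oplus> n) = V_gen_act R \<sigma> a p g m \<oplus> V_gen_act R \<sigma> a p g n"
  by (auto simp: gwa_gens_def \<tau>_add \<sigma>_add l_distr r_distr)

lemma wact_closed: "w \<in> lists (gwa_gens R) \<Longrightarrow> m \<in> carrier R \<Longrightarrow> wact w m \<in> carrier R"
  by (induction w) (auto simp: gen_act_closed)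

lemma wact_add:
  "w \<in> lists (gwa_gens R) \<Longrightarrow> m \<in> carrier R \<Longrightarrow> n \<in> carrier R \<Longrightarrow>
    wact w (m \<oplus> n) = wact w m \<oplus> wact w n"
  by (induction w) (auto simp: gen_act_add wact_closed)

lemma wact_pow:
  assumes "w \<in> lists (gwa_gens R)" "m \<in> carrier R"
  shows "wact w ([(k::int)] \<cdot> m) = [k] \<cdot> wact w m"
proof -
  have "group_hom (add_monoid R) (add_monoid R) (wact w)"
    using assms(1)
    by (auto simp: group_hom_def group_hom_axioms_def hom_def wact_closed wact_add
        intro: add.is_group)
  from group_hom.hom_int_pow[OF this, of m k] assms(2) show ?thesis
    by (simp add: add_pow_def)
qed

lemma pow_0: "[(0::int)] \<cdot> m = \<zero>"
  by (simp add: add_pow_def)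

lemma act_superset:
  assumes "finite S" "Poly_Mapping.keys f \<subseteq> S" "S \<subseteq> lists (gwa_gens R)" "m \<in> carrier R"
  shows "act f m = (\<Oplus>w\<in>S. [Poly_Mapping.lookup f w] \<cdot> wact w m)"
  unfolding V_free_act_def
  using assms
  by (intro add.finprod_mono_neutral_cong_left)
     (auto simp: in_keys_iff pow_0 intro!: add.int_pow_closed wact_closed)

lemma keys_in: "f \<in> carrier F \<Longrightarrow> Poly_Mapping.keys f \<subseteq> lists (gwa_gens R)"
  by (simp add: free_ring_simps)

lemma act_closed:
  assumes "f \<in> carrier F" "m \<in> carrier R"
  shows "act f m \<in> carrier R"
  unfolding V_free_act_def
  using assms keys_in[OF assms(1)] by (auto intro!: finsum_closed add.int_pow_closed wact_closed)

lemma act_add: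
  assumes "f \<in> carrier F" "g \<in> carrier F" "m \<in> carrier R"
  shows "act (f + g) m = act f m \<oplus> act g m"
proof -
  let ?S = "Poly_Mapping.keys f \<union> Poly_Mapping.keys g"
  have S: "?S \<subseteq> lists (gwa_gens R)" using assms keys_in by blast
  have c: "w \<in> ?S \<Longrightarrow> wact w m \<in> carrier R" for w using S assms wact_closed by blast
  have "act (f + g) m = (\<Oplus>w\<in>?S. [Poly_Mapping.lookup (f + g) w] \<cdot> wact w m)"
    using S assms Poly_Mapping.keys_add[of f g] by (intro act_superset) auto
  also have "\<dots> = (\<Oplus>w\<in>?S. [Poly_Mapping.lookup f w] \<cdot> wact w m \<oplus> [Poly_Mapping.lookup g w] \<cdot> wact w m)"
    using c by (intro add.finprod_cong') (auto simp: lookup_add add.int_pow_mult)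
  also have "\<dots> = (\<Oplus>w\<in>?S. [Poly_Mapping.lookup f w] \<cdot> wact w m) \<oplus> (\<Oplus>w\<in>?S. [Poly_Mapping.lookup g w] \<cdot> wact w m)"
    using c by (intro finsum_addf) auto
  also have "\<dots> = act f m \<oplus> act g m"
    using S assms by (simp add: act_superset[of ?S])
  finally show ?thesis .
qed

lemma act_zero: "act 0 m = \<zero>"
  by (simp add: V_free_act_def)

lemma act_uminus:
  assumes "f \<in> carrier F" "m \<in> carrier R"
  shows "act (- f) m = \<ominus> act f m"
proof -
  have "act (- f) m \<oplus> act f m = \<zero>"
    using act_add[of "- f" f m] assms by (simp add: act_zero free_ring_uminus)
  then show ?thesis using assms by (intro minus_equality[symmetric] act_closed free_ring_uminus)
qed

lemma act_minus:
  assumes "f \<in> carrier F" "g \<in> carrier F" "m \<in> carrier R"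
  shows "act (f - g) m = act f m \<ominus> act g m"
  using act_add[of f "- g" m] act_uminus[of g m] assms
  by (simp add: minus_eq free_ring_uminus)

lemma act_single:
  assumes "w \<in> lists (gwa_gens R)" "m \<in> carrier R"
  shows "act (Poly_Mapping.single w k) m = [k] \<cdot> wact w m"
  using act_superset[of "{w}" "Poly_Mapping.single w k" m] assms wact_closed[of w m]
  by (simp add: finsum_insert split: if_splits)

lemma act_gen: "g \<in> gwa_gens R \<Longrightarrow> m \<in> carrier R \<Longrightarrow> act (gen g) m = V_gen_act R \<sigma> a p g m"
  by (simp add: gen_def act_single gen_act_closed add.int_pow_1)

lemma act_one: "m \<in> carrier R \<Longrightarrow> act 1 m = m"
  by (simp add: one_list_single act_single add.int_pow_1)

lemma act_m_add:
  assumes "f \<in> carrier F" "m \<in> carrier R" "n \<in> carrier R"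
  shows "act f (m \<oplus> n) = act f m \<oplus> act f n"
  using assms(1)
proof (induction f rule: free_ring_induct)
  case zero
  then show ?case by (simp add: act_zero)
next
  case (add w k g)
  then have s: "Poly_Mapping.single w k \<in> carrier F" by (auto simp: free_ring_simps)
  have c: "act g m \<in> carrier R" "act g n \<in> carrier R" "wact w m \<in> carrier R" "wact w n \<in> carrier R"
    using add assms act_closed wact_closed by auto
  have k: "[k] \<cdot> (wact w m \<oplus> wact w n) = [k] \<cdot> wact w m \<oplus> [k] \<cdot> wact w n"
    using c by (intro add.int_pow_distrib)
  show ?case
    using add s assms c k by (simp add: act_add act_single wact_add a_ac)
qed

lemma act_single_mult:
  assumes "u \<in> lists (gwa_gens R)" "g \<in> carrier F" "m \<in> carrier R"
  shows "act (Poly_Mapping.single u k * g) m = [k] \<cdot> wact u (act g m)"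
  using assms(2)
proof (induction g rule: free_ring_induct)
  case zero
  have "wact u ([(0::int)] \<cdot> m) = [(0::int)] \<cdot> wact u m" using assms wact_pow by blast
  then have "wact u \<zero> = \<zero>" by (simp add: pow_0)
  then show ?case by (simp add: act_zero pow_0)
next
  case (add w l g)
  then have s: "Poly_Mapping.single w l \<in> carrier F" "Poly_Mapping.single u k \<in> carrier F"
    using assms by (auto simp: free_ring_simps)
  have c: "act g m \<in> carrier R" "wact w m \<in> carrier R" "wact u (act g m) \<in> carrier R"
    "wact u (wact w m) \<in> carrier R" 
    using add assms act_closed wact_closed by auto
  have "Poly_Mapping.single u k * (Poly_Mapping.single w l + g) =
      Poly_Mapping.single (u @ w) (k * l) + Poly_Mapping.single u k * g"
    by (simp add: distrib_left mult_single plus_list_def)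
  moreover have "Poly_Mapping.single (u @ w) (k * l) \<in> carrier F"
    using assms add by (auto simp: free_ring_simps)
  moreover have "act (Poly_Mapping.single (u @ w) (k * l)) m = [k] \<cdot> ([l] \<cdot> wact u (wact w m))"
  proof -
    have "act (Poly_Mapping.single (u @ w) (k * l)) m = [(k * l)] \<cdot> wact (u @ w) m"
      using assms add by (intro act_single) auto
    also have "\<dots> = [k] \<cdot> ([l] \<cdot> wact u (wact w m))"
      using add.int_pow_pow[OF c(4), of k l] by (simp add: mult.commute[of k l])
    finally show ?thesis .
  qed
  moreover have "[k] \<cdot> wact u (act (Poly_Mapping.single w l + g) m) =
      [k] \<cdot> ([l] \<cdot> wact u (wact w m)) \<oplus> [k] \<cdot> wact u (act g m)"
    using assms add s c
    by (simp add: act_add act_single wact_add wact_pow add.int_pow_distrib)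
  ultimately show ?case
    using add s assms by (simp add: act_add free_ring_closed)
qed

lemma act_mult:
  assumes "f \<in> carrier F" "g \<in> carrier F" "m \<in> carrier R"
  shows "act (f * g) m = act f (act g m)"
  using assms(1)
proof (induction f rule: free_ring_induct)
  case zero
  then show ?case by (simp add: act_zero)
next
  case (add w k f)
  then have s: "Poly_Mapping.single w k \<in> carrier F" by (auto simp: free_ring_simps)
  show ?case
    using add s assms
    by (simp add: distrib_right act_add act_closed free_ring_closed act_single_mult act_single)
qed

lemma act_relation:
  assumes "f \<in> gwa_relations R \<sigma> a" "m \<in> carrier R"
  shows "act f m = \<zero>"
proof -
  note S = act_minus act_add act_mult act_gen act_one gens_closed free_ring_closed
    zero_one_in_free_ring gens assms(2) minus_eq r_neg
  have q: "q \<in> carrier R" by simp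
  have xy: "m \<otimes> (cofactor R a p \<otimes> p) = a \<otimes> m"
    using a_eq(1) a_comm assms(2) by simp
  have "\<sigma> p \<otimes> q = \<sigma> a"
    using a_eq(2) \<sigma>_mult[of p "cofactor R a p"] by simp
  then have yx: "m \<otimes> (\<sigma> p \<otimes> q) = \<sigma> a \<otimes> m"
    using \<sigma>a_comm assms(2) by simp
  from assms(1) show ?thesis
    unfolding gwa_relations_def
    by (auto simp: S l_distr m_assoc \<tau>_mult \<sigma>_mult xy yx)
qed

lemma act_ideal:
  assumes "f \<in> I" "m \<in> carrier R"
  shows "act f m = \<zero>"
proof -
  let ?K = "{f \<in> carrier F. \<forall>m\<in>carrier R. act f m = \<zero>}"
  have act0: "act f \<zero> = \<zero>" if "f \<in> carrier F" for f
    using act_m_add[OF that, of \<zero> \<zero>] act_closed[OF that, of \<zero>]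
    by (metis add.l_cancel_one zero_closed l_zero)
  have "ideal ?K F"
  proof (rule idealI[OF ring_free_ring])
    show "subgroup ?K (add_monoid F)"
    proof (rule group.subgroupI)
      show "Group.group (add_monoid F)"
        using ring_free_ring abelian_group.a_group ring.is_abelian_group by blast
      show "?K \<noteq> {}"
        using act_zero zero_one_in_free_ring(1) by blast
      fix f assume f: "f \<in> ?K"
      have "inv\<^bsub>add_monoid F\<^esub> f = - f"
        using f abelian_group.minus_equality[OF ring.is_abelian_group[OF ring_free_ring[of "gwa_gens R"]], of "- f" f]
        by (simp add: free_ring_simps(2-) free_ring_uminus a_inv_def)
      then show "inv\<^bsub>add_monoid F\<^esub> f \<in> ?K"
        using f by (auto simp: act_uminus free_ring_uminus)
    qed (use zero_one_in_free_ring in \<open>auto simp: act_zero act_add free_ring_closed free_ring_simps(2-)\<close>)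
  qed (auto simp: act_mult free_ring_closed free_ring_simps(2-) act_closed act0)
  moreover have "gwa_relations R \<sigma> a \<subseteq> ?K"
    using relations_closed act_relation by auto
  ultimately have "I \<subseteq> ?K"
    unfolding gwa_ideal_def by (rule ring.genideal_minimal[OF ring_free_ring])
  with assms show ?thesis by blast
qed

lemma V_smult_coset:
  assumes "f \<in> carrier F" "m \<in> carrier R"
  shows "(I +>\<^bsub>F\<^esub> f) \<odot>\<^bsub>V_module R \<sigma> a p\<^esub> m = act f m"
proof -
  have "act g m = act f m" if g: "g \<in> I +>\<^bsub>F\<^esub> f" for g
  proof -
    obtain h where h: "h \<in> I" "g = h + f"
      using g by (auto simp: a_r_coset_def r_coset_def free_ring_simps(2-))
    then have "h \<in> carrier F"
      using ideal.Icarr[OF ideal_I] by blast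
    with h assms show ?thesis by (simp add: act_add act_ideal act_closed)
  qed
  moreover have "f \<in> I +>\<^bsub>F\<^esub> f"
  proof -
    have "0 \<in> I"
      using additive_subgroup.zero_closed[OF ideal.axioms(1)[OF ideal_I]]
      by (simp add: free_ring_simps(2-))
    then show ?thesis
      unfolding a_r_coset_def r_coset_def by (auto simp: free_ring_simps(2-) intro!: bexI[of _ 0])
  qed
  ultimately have "(\<lambda>g. act g m) ` (I +>\<^bsub>F\<^esub> f) = {act f m}"
    by (intro equalityI subsetI; blast)
  then show ?thesis by (simp add: V_module_def)
qed

theorem V_actions:
  assumes "r \<in> carrier R"
  shows "r' \<in> carrier R \<Longrightarrow> gwa_coeff R \<sigma> a r' \<odot>\<^bsub>V_module R \<sigma> a p\<^esub> r = r' \<otimes> r"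
    and "gwa_gen_class R \<sigma> a GenX \<odot>\<^bsub>V_module R \<sigma> a p\<^esub> r = \<tau> r \<otimes> p"
    and "gwa_gen_class R \<sigma> a GenY \<odot>\<^bsub>V_module R \<sigma> a p\<^esub> r = \<sigma> r \<otimes> q"
  using assms
  by (simp_all add: gwa_coeff_def gwa_gen_class_def V_smult_coset gens_closed act_gen gens)

theorem left_module_V: "left_module (GWA R \<sigma> a) (V_module R \<sigma> a p)"
proof -
  let ?V = "V_module R \<sigma> a p" and ?A = "GWA R \<sigma> a"
  have V: "carrier ?V = carrier R" "zero ?V = \<zero>" "add ?V = add R"
    by (simp_all add: V_module_def)
  have ab: "abelian_group ?V"
    by (rule abelian_groupI) (auto simp: V a_ac intro!: bexI[of _ "\<ominus> _"] l_neg)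
  have rep: "\<exists>f\<in>carrier F. \<alpha> = I +>\<^bsub>F\<^esub> f" if "\<alpha> \<in> carrier ?A" for \<alpha>
    using that by (auto simp: GWA_def FactRing_def A_RCOSETS_def RCOSETS_def a_r_coset_def)
  have sum: "(I +>\<^bsub>F\<^esub> f) \<oplus>\<^bsub>?A\<^esub> (I +>\<^bsub>F\<^esub> g) = I +>\<^bsub>F\<^esub> (f + g)"
    if "f \<in> carrier F" "g \<in> carrier F" for f g
    using ideal.a_rcos_sum[OF ideal_I] that
    by (simp add: GWA_def FactRing_def free_ring_simps(2-))
  have prod: "(I +>\<^bsub>F\<^esub> f) \<otimes>\<^bsub>?A\<^esub> (I +>\<^bsub>F\<^esub> g) = I +>\<^bsub>F\<^esub> (f * g)"
    if "f \<in> carrier F" "g \<in> carrier F" for f g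
    using ideal.rcoset_mult_add[OF ideal_I] that
    by (simp add: GWA_def FactRing_def free_ring_simps(2-))
  have one: "\<one>\<^bsub>?A\<^esub> = I +>\<^bsub>F\<^esub> 1"
    by (simp add: GWA_def FactRing_def free_ring_simps(2-))
  show ?thesis
  proof (intro left_module.intro left_module_axioms.intro ring_GWA ab)
    fix \<alpha> \<beta> m n assume m: "m \<in> carrier ?V"
    show "\<one>\<^bsub>?A\<^esub> \<odot>\<^bsub>?V\<^esub> m = m"
      using m by (simp add: one V V_smult_coset zero_one_in_free_ring act_one)
    assume \<alpha>: "\<alpha> \<in> carrier ?A"
    then obtain f where f: "f \<in> carrier F" "\<alpha> = I +>\<^bsub>F\<^esub> f" using rep by blast
    show "\<alpha> \<odot>\<^bsub>?V\<^esub> m \<in> carrier ?V" using f m by (simp add: V V_smult_coset act_closed)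
    {
      assume "n \<in> carrier ?V"
      then show "\<alpha> \<odot>\<^bsub>?V\<^esub> (m \<oplus>\<^bsub>?V\<^esub> n) = \<alpha> \<odot>\<^bsub>?V\<^esub> m \<oplus>\<^bsub>?V\<^esub> \<alpha> \<odot>\<^bsub>?V\<^esub> n"
        using f m by (simp add: V V_smult_coset act_m_add)
    next
      assume "\<beta> \<in> carrier ?A"
      then obtain g where g: "g \<in> carrier F" "\<beta> = I +>\<^bsub>F\<^esub> g" using rep by blast
      show "(\<alpha> \<oplus>\<^bsub>?A\<^esub> \<beta>) \<odot>\<^bsub>?V\<^esub> m = \<alpha> \<odot>\<^bsub>?V\<^esub> m \<oplus>\<^bsub>?V\<^esub> \<beta> \<odot>\<^bsub>?V\<^esub> m"
        using f g m by (simp add: V sum V_smult_coset act_add free_ring_closed)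
      show "(\<alpha> \<otimes>\<^bsub>?A\<^esub> \<beta>) \<odot>\<^bsub>?V\<^esub> m = \<alpha> \<odot>\<^bsub>?V\<^esub> (\<beta> \<odot>\<^bsub>?V\<^esub> m)"
        using f g m by (simp add: V prod V_smult_coset act_mult act_closed free_ring_closed)
    }
  qed
qed

end

end

theory Submission
  imports Defs
begin

text \<open>
  Let \<open>h\<close> be the isomorphism onto the regular module, \<open>e\<close> the preimage of \<open>1\<close>, and put
  \<open>p = h (x e)\<close>, \<open>q = h (y e)\<close>. Since \<open>x r = \<sigma>\<^sup>-\<^sup>1(r) x\<close> and \<open>y r = \<sigma>(r) y\<close>, transporting the action along
  \<open>h\<close> gives \<open>x \<cdot> r = \<sigma>\<^sup>-\<^sup>1(r) p\<close> and \<open>y \<cdot> r = \<sigma>(r) q\<close>. Applying \<open>x y = a\<close> to \<open>e\<close> yields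
  \<open>a = \<sigma>\<^sup>-\<^sup>1(q) p\<close>, so \<open>p\<close> divides \<open>a\<close> and \<open>q = \<sigma>(a/p)\<close>.
\<close>

section \<open>Generating the free ring by its ring operations\<close>

lemma gen_Cons: "Poly_Mapping.single (g # w) 1 = gen g * Poly_Mapping.single w 1"
  by (simp add: gen_def mult_single plus_list_def)

text \<open>A word is a product of generators, a monomial is a repeated sum of a word up to sign,
  and every element is a finite sum of monomials. This reduces a claim about all elements to the
  generators when it is stable under the ring operations.\<close>

lemma free_ring_gen_induct [consumes 1, case_names one gen add uminus mult]:
  assumes f: "f \<in> carrier (free_ring G)"
    and one: "P 1"
    and gen: "\<And>g. g \<in> G \<Longrightarrow> P (gen g)"
    and add: "\<And>f g. \<lbrakk>f \<in> carrier (free_ring G); g \<in> carrier (free_ring G); P f; P g\<rbrakk> \<Longrightarrow> P (f + g)"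
    and uminus: "\<And>f. \<lbrakk>f \<in> carrier (free_ring G); P f\<rbrakk> \<Longrightarrow> P (- f)"
    and mult: "\<And>f g. \<lbrakk>f \<in> carrier (free_ring G); g \<in> carrier (free_ring G); P f; P g\<rbrakk> \<Longrightarrow> P (f * g)"
  shows "P f"
proof -
  let ?C = "carrier (free_ring G)"
  \<comment> \<open>There is no separate case for zero, because 0 = 1 + (-1).\<close>
  have zero: "P 0"
    using add[of 1 "- 1"] one uminus[of 1] zero_one_in_free_ring(2) free_ring_uminus by force
  have word: "Poly_Mapping.single w 1 \<in> ?C \<and> P (Poly_Mapping.single w 1)" if "w \<in> lists G" for w
    using that
  proof (induction w)
    case Nil
    then show ?case using one zero_one_in_free_ring by (simp add: one_list_single)
  next
    case (Cons g w)
    then show ?case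
      by (simp only: gen_Cons) (auto intro!: mult gen free_ring_closed gen_in_free_ring)
  qed
  have pos: "Poly_Mapping.single w (int n) \<in> ?C \<and> P (Poly_Mapping.single w (int n))"
    if "w \<in> lists G" for w n
    using word[OF that]
    by (induction n) (auto simp: zero zero_one_in_free_ring single_add intro!: add free_ring_closed)
  \<comment> \<open>An integer coefficient is n or -n with n natural, so the sign is handled by
    closure under negation.\<close>
  have monomial: "Poly_Mapping.single w k \<in> ?C \<and> P (Poly_Mapping.single w k)"
    if w: "w \<in> lists G" for w k
  proof (cases k rule: int_cases2)
    case (nonneg n)
    then show ?thesis using pos[OF w] by simp
  next
    case (nonpos n)
    then show ?thesis using pos[OF w, of n] free_ring_uminus uminus by (metis single_uminus)
  qed
  show ?thesis
    using f
  proof (induction f rule: free_ring_induct)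
    case zero
    show ?case by (fact \<open>P 0\<close>)
  next
    case (add w k g)
    \<comment> \<open>\<open>assms(4)\<close> is closure under sums, applied to the leading monomial
      and the rest.\<close>
    then show ?case using monomial[of w k] assms(4) by blast
  qed
qed

section \<open>Zero and negatives in left modules\<close>

context left_module
begin

lemma smult_l_zero: assumes "m \<in> carrier M" shows "\<zero> \<odot>\<^bsub>M\<^esub> m = \<zero>\<^bsub>M\<^esub>"
proof -
  have "\<zero> \<odot>\<^bsub>M\<^esub> m \<oplus>\<^bsub>M\<^esub> \<zero> \<odot>\<^bsub>M\<^esub> m = \<zero> \<odot>\<^bsub>M\<^esub> m"
    using smult_l_distr[of \<zero> \<zero> m] assms by simp
  then show ?thesis using assms by (simp add: smult_closed M.add.l_cancel_one)
qed

lemma smult_l_minus: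
  assumes "r \<in> carrier R" "m \<in> carrier M"
  shows "(\<ominus> r) \<odot>\<^bsub>M\<^esub> m = \<ominus>\<^bsub>M\<^esub> (r \<odot>\<^bsub>M\<^esub> m)"
proof -
  have "(\<ominus> r) \<odot>\<^bsub>M\<^esub> m \<oplus>\<^bsub>M\<^esub> r \<odot>\<^bsub>M\<^esub> m = \<zero>\<^bsub>M\<^esub>"
    using smult_l_distr[of "\<ominus> r" r m] assms by (simp add: R.l_neg smult_l_zero)
  then show ?thesis using assms by (simp add: M.minus_equality smult_closed)
qed

end

section \<open>The algebra as a quotient and its modules of rank one\<close>

context gwa_data
begin

abbreviation "A \<equiv> GWA R \<sigma> a"
abbreviation "cls f \<equiv> I +>\<^bsub>F\<^esub> f"

lemma cls_hom: "cls \<in> ring_hom F A"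
  unfolding GWA_def by (rule ideal.rcos_ring_hom[OF ideal_I])

lemma cls_closed: "f \<in> carrier F \<Longrightarrow> cls f \<in> carrier A"
  and cls_add: "\<lbrakk>f \<in> carrier F; g \<in> carrier F\<rbrakk> \<Longrightarrow> cls (f + g) = cls f \<oplus>\<^bsub>A\<^esub> cls g"
  and cls_mult: "\<lbrakk>f \<in> carrier F; g \<in> carrier F\<rbrakk> \<Longrightarrow> cls (f * g) = cls f \<otimes>\<^bsub>A\<^esub> cls g"
  and cls_one: "cls 1 = \<one>\<^bsub>A\<^esub>"
  using ring_hom_closed[OF cls_hom] ring_hom_add[OF cls_hom] ring_hom_mult[OF cls_hom]
    ring_hom_one[OF cls_hom]
  by (simp_all add: free_ring_simps(2-))

lemma cls_zero: "cls 0 = \<zero>\<^bsub>A\<^esub>"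
  using ring_hom_zero[OF cls_hom ring_free_ring ring_GWA] by (simp add: free_ring_simps)

lemma cls_uminus:
  assumes "f \<in> carrier F"
  shows "cls (- f) = \<ominus>\<^bsub>A\<^esub> cls f"
proof -
  interpret A: ring A by (rule ring_GWA)
  have "cls (- f) \<oplus>\<^bsub>A\<^esub> cls f = \<zero>\<^bsub>A\<^esub>"
    using cls_add[of "- f" f] assms by (simp add: free_ring_uminus cls_zero)
  then show ?thesis using assms by (simp add: A.minus_equality cls_closed free_ring_uminus)
qed

lemma cls_surj: "\<alpha> \<in> carrier A \<Longrightarrow> \<exists>f\<in>carrier F. \<alpha> = cls f"
  by (auto simp: GWA_def FactRing_def A_RCOSETS_def RCOSETS_def a_r_coset_def)

text \<open>The relations generate the ideal, so the difference lies in it and has class zero. This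
  turns a relation listed as a difference back into an equation in \<open>A\<close>.\<close>

lemma cls_relation:
  assumes "f - g \<in> gwa_relations R \<sigma> a" "f \<in> carrier F" "g \<in> carrier F"
  shows "cls f = cls g"
proof -
  interpret A: ring A by (rule ring_GWA)
  have I: "f - g \<in> I"
    unfolding gwa_ideal_def
    using ring.genideal_self[OF ring_free_ring relations_closed] assms(1) by blast
  have "cls (f - g) = \<zero>\<^bsub>A\<^esub>"
    using ring.a_rcos_zero[OF ring_free_ring ideal_I I] by (simp add: GWA_def FactRing_def)
  moreover have "cls (f - g) \<oplus>\<^bsub>A\<^esub> cls g = cls f"
    using cls_add[of "f - g" g] assms by (simp add: free_ring_closed)
  ultimately show ?thesis using assms by (simp add: cls_closed)
qed

lemma GWA_gen_closed: "g \<in> gwa_gens R \<Longrightarrow> gwa_gen_class R \<sigma> a g \<in> carrier A"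
  by (simp add: gwa_gen_class_def cls_closed gen_in_free_ring)

lemma GWA_relations:
  shows "r \<in> carrier R \<Longrightarrow> gwa_gen_class R \<sigma> a GenX \<otimes>\<^bsub>A\<^esub> gwa_coeff R \<sigma> a (\<sigma> r) =
      gwa_coeff R \<sigma> a r \<otimes>\<^bsub>A\<^esub> gwa_gen_class R \<sigma> a GenX"
    and "r \<in> carrier R \<Longrightarrow> gwa_gen_class R \<sigma> a GenY \<otimes>\<^bsub>A\<^esub> gwa_coeff R \<sigma> a r =
      gwa_coeff R \<sigma> a (\<sigma> r) \<otimes>\<^bsub>A\<^esub> gwa_gen_class R \<sigma> a GenY"
    and "gwa_gen_class R \<sigma> a GenX \<otimes>\<^bsub>A\<^esub> gwa_gen_class R \<sigma> a GenY = gwa_coeff R \<sigma> a a"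
proof -
  show "gwa_gen_class R \<sigma> a GenX \<otimes>\<^bsub>A\<^esub> gwa_coeff R \<sigma> a (\<sigma> r) =
      gwa_coeff R \<sigma> a r \<otimes>\<^bsub>A\<^esub> gwa_gen_class R \<sigma> a GenX" if r: "r \<in> carrier R"
  proof -
    have "gen GenX * gen (Coeff (\<sigma> r)) - gen (Coeff r) * gen GenX \<in> gwa_relations R \<sigma> a"
      unfolding gwa_relations_def using r by blast
    from cls_relation[OF this] r show ?thesis
      by (simp add: gwa_coeff_def gwa_gen_class_def cls_mult gens_closed free_ring_closed)
  qed
  show "gwa_gen_class R \<sigma> a GenY \<otimes>\<^bsub>A\<^esub> gwa_coeff R \<sigma> a r =
      gwa_coeff R \<sigma> a (\<sigma> r) \<otimes>\<^bsub>A\<^esub> gwa_gen_class R \<sigma> a GenY" if r: "r \<in> carrier R"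
  proof -
    have "gen GenY * gen (Coeff r) - gen (Coeff (\<sigma> r)) * gen GenY \<in> gwa_relations R \<sigma> a"
      unfolding gwa_relations_def using r by blast
    from cls_relation[OF this] r show ?thesis
      by (simp add: gwa_coeff_def gwa_gen_class_def cls_mult gens_closed free_ring_closed)
  qed
  have "gen GenX * gen GenY - gen (Coeff a) \<in> gwa_relations R \<sigma> a"
    unfolding gwa_relations_def by blast
  from cls_relation[OF this]
  show "gwa_gen_class R \<sigma> a GenX \<otimes>\<^bsub>A\<^esub> gwa_gen_class R \<sigma> a GenY = gwa_coeff R \<sigma> a a"
    by (simp add: gwa_coeff_def gwa_gen_class_def cls_mult gens_closed free_ring_closed)
qed

text \<open>The elements of the free ring whose classes commute with \<open>h\<close> are closed
  under the ring operations, so it is enough to test the generators.\<close>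

lemma gwa_module_isoI:
  assumes "left_module A M" "left_module A N"
    and bij: "bij_betw h (carrier M) (carrier N)"
    and h_add: "\<And>m n. \<lbrakk>m \<in> carrier M; n \<in> carrier M\<rbrakk> \<Longrightarrow> h (m \<oplus>\<^bsub>M\<^esub> n) = h m \<oplus>\<^bsub>N\<^esub> h n"
    and h_gen: "\<And>g m. \<lbrakk>g \<in> gwa_gens R; m \<in> carrier M\<rbrakk> \<Longrightarrow>
      h (gwa_gen_class R \<sigma> a g \<odot>\<^bsub>M\<^esub> m) = gwa_gen_class R \<sigma> a g \<odot>\<^bsub>N\<^esub> h m"
  shows "h \<in> left_module_iso A M N"
proof -
  interpret M: left_module A M by fact
  interpret N: left_module A N by fact
  have hc: "h m \<in> carrier N" if "m \<in> carrier M" for m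
    using bij that by (rule bij_betw_apply)
  have h_zero: "h \<zero>\<^bsub>M\<^esub> = \<zero>\<^bsub>N\<^esub>"
    using h_add[of "\<zero>\<^bsub>M\<^esub>" "\<zero>\<^bsub>M\<^esub>"] hc[of "\<zero>\<^bsub>M\<^esub>"] N.M.add.l_cancel_one[of "h \<zero>\<^bsub>M\<^esub>" "h \<zero>\<^bsub>M\<^esub>"]
    by simp
  have h_uminus: "h (\<ominus>\<^bsub>M\<^esub> m) = \<ominus>\<^bsub>N\<^esub> h m" if m: "m \<in> carrier M" for m
    using h_add[of "\<ominus>\<^bsub>M\<^esub> m" m] m
    by (intro N.M.minus_equality[symmetric]) (auto simp: h_zero hc M.M.l_neg)
  \<comment> \<open>The vector stays arbitrary because, for a product, the hypothesis on the left
    factor is used at the vector \<open>cls g\<close> times \<open>m\<close>.\<close>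
  have "h (cls f \<odot>\<^bsub>M\<^esub> m) = cls f \<odot>\<^bsub>N\<^esub> h m" if "f \<in> carrier F" "m \<in> carrier M" for f m
    using that
  proof (induction f arbitrary: m rule: free_ring_gen_induct)
    case one
    then show ?case by (simp add: cls_one M.smult_one N.smult_one hc)
  next
    case (gen g)
    then show ?case using h_gen by (simp add: gwa_gen_class_def)
  next
    case (add f g)
    then show ?case
      by (simp add: cls_add cls_closed M.smult_l_distr N.smult_l_distr M.smult_closed h_add hc)
  next
    case (uminus f)
    then show ?case
      by (simp add: cls_uminus cls_closed M.smult_l_minus N.smult_l_minus M.smult_closed h_uminus hc)
  next
    case (mult f g)
    then show ?case
      by (simp add: cls_mult cls_closed M.smult_assoc N.smult_assoc M.smult_closed hc)
  qed
  \<comment> \<open>Every element of the quotient is the class of some element of the free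
    ring.\<close>
  then have "h (\<alpha> \<odot>\<^bsub>M\<^esub> m) = \<alpha> \<odot>\<^bsub>N\<^esub> h m" if "\<alpha> \<in> carrier A" "m \<in> carrier M" for \<alpha> m
    using cls_surj[OF that(1)] that(2) by blast
  then show ?thesis using bij h_add by (simp add: left_module_iso_def)
qed

text \<open>The given \<open>h\<close> itself turns out to be A-linear: the actions of x and y are
  determined by their values on the basis vector \<open>e\<close>, and these values determine
  \<open>p\<close>.\<close>

lemma rank_one_module_iso_V:
  assumes M: "left_module A M"
    and h: "h \<in> left_module_iso R (restrict_scalars (gwa_coeff R \<sigma> a) M) (regular_module R)"
  shows "\<exists>p\<in>carrier R. central_divides R p a \<and> h \<in> left_module_iso A M (V_module R \<sigma> a p)"
proof -
  interpret M: left_module A M by fact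
  let ?c = "gwa_coeff R \<sigma> a"
    and ?x = "gwa_gen_class R \<sigma> a GenX" and ?y = "gwa_gen_class R \<sigma> a GenY"
  have bij: "bij_betw h (carrier M) (carrier R)"
    and h_add: "\<And>m n. \<lbrakk>m \<in> carrier M; n \<in> carrier M\<rbrakk> \<Longrightarrow> h (m \<oplus>\<^bsub>M\<^esub> n) = h m \<oplus> h n"
    and h_coeff: "\<And>r m. \<lbrakk>r \<in> carrier R; m \<in> carrier M\<rbrakk> \<Longrightarrow> h (?c r \<odot>\<^bsub>M\<^esub> m) = r \<otimes> h m"
    using h by (simp_all add: left_module_iso_def restrict_scalars_def regular_module_def)
  have x [simp]: "?x \<in> carrier A" and y [simp]: "?y \<in> carrier A"
    and c [simp]: "\<And>r. r \<in> carrier R \<Longrightarrow> ?c r \<in> carrier A"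
    by (simp_all add: gwa_coeff_def GWA_gen_closed gens)
  have hc [simp]: "h m \<in> carrier R" if "m \<in> carrier M" for m
    using bij that by (rule bij_betw_apply)
  obtain e where e [simp]: "e \<in> carrier M" and he: "h e = \<one>"
    using bij by (metis bij_betw_imp_surj_on imageE one_closed)
  \<comment> \<open>Both sides have the same image under the injective map \<open>h\<close>, since
    \<open>h e\<close> is 1; so \<open>e\<close> is a basis of the restriction to R.\<close>
  have repr: "m = ?c (h m) \<odot>\<^bsub>M\<^esub> e" if "m \<in> carrier M" for m
    using that h_coeff[of "h m" e] he
    by (intro inj_onD[OF bij_betw_imp_inj_on[OF bij]]) (auto simp: M.smult_closed)
  \<comment> \<open>This choice is forced if \<open>e\<close> is to correspond to 1, since x sends 1
    to \<open>p\<close> in the target module.\<close>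
  define p where "p = h (?x \<odot>\<^bsub>M\<^esub> e)"
  define q where "q = h (?y \<odot>\<^bsub>M\<^esub> e)"
  have p [simp]: "p \<in> carrier R" and q [simp]: "q \<in> carrier R"
    by (simp_all add: p_def q_def M.smult_closed)
  have hx: "h (?x \<odot>\<^bsub>M\<^esub> m) = \<tau> (h m) \<otimes> p" if m: "m \<in> carrier M" for m
  proof -
    \<comment> \<open>The coefficient \<open>h m\<close> is written as
      \<open>\<sigma> (\<tau> (h m))\<close> so that x\<sigma>(r) = rx applies with r =
      \<open>\<tau> (h m)\<close>.\<close>
    have "?x \<odot>\<^bsub>M\<^esub> m = (?x \<otimes>\<^bsub>A\<^esub> ?c (\<sigma> (\<tau> (h m)))) \<odot>\<^bsub>M\<^esub> e"
      using m repr[OF m] by (simp add: M.smult_assoc)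
    also have "\<dots> = ?c (\<tau> (h m)) \<odot>\<^bsub>M\<^esub> (?x \<odot>\<^bsub>M\<^esub> e)"
      using m GWA_relations(1)[of "\<tau> (h m)"] by (simp add: M.smult_assoc del: \<sigma>_\<tau>)
    finally show ?thesis using m by (simp add: h_coeff M.smult_closed p_def)
  qed
  have hy: "h (?y \<odot>\<^bsub>M\<^esub> m) = \<sigma> (h m) \<otimes> q" if m: "m \<in> carrier M" for m
  proof -
    have "?y \<odot>\<^bsub>M\<^esub> m = (?y \<otimes>\<^bsub>A\<^esub> ?c (h m)) \<odot>\<^bsub>M\<^esub> e"
      using m repr[OF m] by (simp add: M.smult_assoc)
    also have "\<dots> = ?c (\<sigma> (h m)) \<odot>\<^bsub>M\<^esub> (?y \<odot>\<^bsub>M\<^esub> e)"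
      using m GWA_relations(2)[of "h m"] by (simp add: M.smult_assoc)
    finally show ?thesis using m by (simp add: h_coeff M.smult_closed q_def)
  qed
  have a_eq: "a = \<tau> q \<otimes> p"
  proof -
    have "a = h (?c a \<odot>\<^bsub>M\<^esub> e)" by (simp add: h_coeff he)
    \<comment> \<open>The relation xy = a is read from right to left; the formula \<open>hx\<close>
      is then used at the vector y times \<open>e\<close>.\<close>
    also have "\<dots> = h (?x \<odot>\<^bsub>M\<^esub> (?y \<odot>\<^bsub>M\<^esub> e))"
      by (simp add: M.smult_assoc flip: GWA_relations(3))
    also have "\<dots> = \<tau> q \<otimes> p" by (simp add: hx M.smult_closed q_def)
    finally show ?thesis .
  qed
  then have div: "central_divides R p a"
    using p \<tau>_closed[OF q] unfolding central_divides_def by blast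
  \<comment> \<open>Divisibility is what makes the action on the target well defined on cosets, so
    its module structure becomes available here.\<close>
  interpret V: gwa_divisor R \<sigma> a p by unfold_locales (rule div)
  \<comment> \<open>Cofactors are unique, so that of \<open>p\<close> is \<open>\<tau> q\<close>.
    Hence y acts on the target through the same \<open>q\<close> as in \<open>hy\<close>.\<close>
  have cof: "\<sigma> (cofactor R a p) = q"
    using cofactor_eq[OF p \<tau>_closed[OF q] a_eq] by simp
  have "h \<in> left_module_iso A M (V_module R \<sigma> a p)"
  proof (rule gwa_module_isoI[OF M V.left_module_V])
    fix g m assume "g \<in> gwa_gens R" and m: "m \<in> carrier M"
    then consider (C) r where "r \<in> carrier R" "g = Coeff r" | (X) "g = GenX" | (Y) "g = GenY"
      by (auto simp: gwa_gens_def)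
    then show "h (gwa_gen_class R \<sigma> a g \<odot>\<^bsub>M\<^esub> m) =
        gwa_gen_class R \<sigma> a g \<odot>\<^bsub>V_module R \<sigma> a p\<^esub> h m"
    proof cases
      case C
      then show ?thesis
        using m h_coeff V.V_actions(1) by (simp flip: gwa_coeff_def)
    next
      case X
      then show ?thesis using m by (simp add: hx V.V_actions)
    next
      case Y
      then show ?thesis using m by (simp add: hy V.V_actions cof)
    qed
  qed (use bij h_add in \<open>simp_all add: V_module_def\<close>)
  with div p show ?thesis by blast
qed

end

theorem proposition1p12:
  fixes R :: "('r, 'b) ring_scheme"
    and \<sigma> :: "'r \<Rightarrow> 'r" and a :: 'r
    and M :: "(('r gwa_gen list \<Rightarrow>\<^sub>0 int) set, 'm, 'c) module_scheme"
  assumes "noncomm_domain R"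
    and "invariant_basis_number R"
    and "\<sigma> \<in> ring_iso R R"
    and "a \<in> ring_center R" and "a \<noteq> \<zero>\<^bsub>R\<^esub>"
    and "left_module (GWA R \<sigma> a) M"
    and "left_module_isomorphic R (restrict_scalars (gwa_coeff R \<sigma> a) M) (regular_module R)"
  shows "\<exists>p\<in>carrier R. central_divides R p a \<and>
           left_module_isomorphic (GWA R \<sigma> a) M (V_module R \<sigma> a p)"
proof -
  interpret gwa_data R \<sigma> a
    using assms by (simp add: gwa_data_def gwa_data_axioms_def)
  obtain h where "h \<in> left_module_iso R (restrict_scalars (gwa_coeff R \<sigma> a) M) (regular_module R)"
    using assms(7) by (auto simp: left_module_isomorphic_def)
  from rank_one_module_iso_V[OF assms(6) this] show ?thesis
    by (auto simp: left_module_isomorphic_def)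
qed

end
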